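(* Let $n\ge2$. For any $R>0$ and all $u\in C_c^\infty(B_R^+)$, $$\int_{B_R^+}|\nabla u|^2dx\ \ge\ \frac{n^2}{4}\int_{B_R^+}\frac{u^2}{|x|^2}dx+\frac14\sum_{i=1}^\infty\int_{B_R^+}\frac{u^2}{|x|^2}X_1^2\cdots X_i^2dx+\frac{1}{8R^{1/2}}\int_{B_R^+}\frac{u^2}{|x|^{3/2}}dx,$$ where $X_i=X_i(|x|/(\kappa R))$.
   Context: $B_R^+=\{x\in\mathbb{R}^n:\ |x|<R,\ x_n>0\}$. Iterated logarithms: $X_1(t)=\frac{1}{1-\ln t}$, $X_{k+1}(t)=X_k(X_1(t))$ for $t\in(0,1]$. The series $\sum_{i\ge1}X_1(t)\cdots X_i(t)$ converges for $t\in(0,1)$ and is strictly increasing in $t$; $\kappa>1$ is the unique number with $\sum_{i=1}^\infty X_1(1/\kappa)\cdots X_i(1/\kappa)=\frac14$. *)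

theory Defs
  imports "HOL-Analysis.Analysis"
begin

(* Finite index types carry no order, so an arbitrary coordinate m takes the role of the last one. *)
definition half_ball :: "'n::finite \<Rightarrow> real \<Rightarrow> (real^'n) set" where
  "half_ball m R = {x. norm x < R \<and> 0 < x $ m}"

definition partial_deriv :: "'n::finite \<Rightarrow> (real^'n \<Rightarrow> real) \<Rightarrow> real^'n \<Rightarrow> real" where
  "partial_deriv i u x = frechet_derivative u (at x) (axis i 1)"

definition grad :: "(real^'n::finite \<Rightarrow> real) \<Rightarrow> real^'n \<Rightarrow> real^'n" where
  "grad u x = (\<chi> i. partial_deriv i u x)"

primrec C_k :: "nat \<Rightarrow> (real^'n::finite \<Rightarrow> real) \<Rightarrow> bool" where
  "C_k 0 u \<longleftrightarrow> continuous_on UNIV u"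
| "C_k (Suc k) u \<longleftrightarrow> u differentiable_on UNIV \<and> (\<forall>i. C_k k (partial_deriv i u))"

definition support :: "(real^'n::finite \<Rightarrow> real) \<Rightarrow> (real^'n) set" where
  "support u = closure {x. u x \<noteq> 0}"

(* A test function on an open set \<Omega> is identified with its extension by zero to the whole space. *)
definition test_functions :: "(real^'n::finite) set \<Rightarrow> (real^'n \<Rightarrow> real) set" where
  "test_functions \<Omega> = {u. (\<forall>k. C_k k u) \<and> compact (support u) \<and> support u \<subseteq> \<Omega>}"

(* The iterated logarithms; the index 0 stands for the identity, which makes
   iter_log 1 t = 1 / (1 - ln t).  Only arguments in (0,1] are meaningful. *)
primrec iter_log :: "nat \<Rightarrow> real \<Rightarrow> real" where
  "iter_log 0 t = t"
| "iter_log (Suc k) t = iter_log k (1 / (1 - ln t))"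

lemma iter_log_1: "iter_log 1 t = 1 / (1 - ln t)"
  by simp

lemma iter_log_Suc: "iter_log (Suc k) t = iter_log k (iter_log 1 t)"
  by simp

(* Existence and uniqueness are established in kappa_unique below. *)
definition kappa :: real where
  "kappa = (THE \<kappa>. 1 < \<kappa> \<and> (\<lambda>i. \<Prod>j=1..Suc i. iter_log j (1 / \<kappa>)) sums (1 / 4))"

lemma iter_log_mono:
  assumes "0 < s" "s \<le> t" "t < 1"
  shows "0 < iter_log k s \<and> iter_log k s \<le> iter_log k t \<and> iter_log k t < 1"
  using assms
proof (induction k arbitrary: s t)
  case 0
  then show ?case by simp
next
  case (Suc k)
  have "ln s \<le> ln t" "ln t < 0" using Suc.prems by auto
  then have "0 < 1 / (1 - ln s)" "1 / (1 - ln s) \<le> 1 / (1 - ln t)" "1 / (1 - ln t) < 1"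
    by (auto simp: field_simps)
  from Suc.IH[OF this] show ?case by simp
qed

lemma iter_log_continuous: "continuous_on {0<..<1} (iter_log k)"
proof (induction k)
  case 0
  then show ?case by (simp add: continuous_on_id)
next
  case (Suc k)
  have "continuous_on {0<..<1} (\<lambda>t::real. 1 / (1 - ln t))"
  proof (intro continuous_intros ballI)
    fix t :: real assume "t \<in> {0<..<1}"
    then have "ln t < 0" by simp
    then show "1 - ln t \<noteq> 0" by simp
  qed auto
  moreover have "(\<lambda>t::real. 1 / (1 - ln t)) ` {0<..<1} \<subseteq> {0<..<1}"
    using iter_log_mono[of t t "Suc 0" for t] by auto
  ultimately show ?case
    using continuous_on_compose2[OF Suc] by simp
qed

lemma iter_log_prod_Suc:
  "(\<Prod>j=1..Suc (Suc i). iter_log j t) = iter_log 1 t * (\<Prod>j=1..Suc i. iter_log j (iter_log 1 t))"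
proof -
  have "(\<Prod>j=1..Suc (Suc i). iter_log j t) = iter_log 1 t * (\<Prod>j=Suc 1..Suc (Suc i). iter_log j t)"
    by (subst prod.atLeast_Suc_atMost) auto
  also have "(\<Prod>j=Suc 1..Suc (Suc i). iter_log j t) = (\<Prod>j=1..Suc i. iter_log j (iter_log 1 t))"
    by (subst prod.atLeast_Suc_atMost_Suc_shift) simp
  finally show ?thesis .
qed

lemma iter_log_prod_mono:
  assumes "0 < s" "s \<le> t" "t < 1"
  shows "0 < (\<Prod>j=1..Suc i. iter_log j s)"
    and "(\<Prod>j=1..Suc i. iter_log j s) \<le> (\<Prod>j=1..Suc i. iter_log j t)"
  using iter_log_mono[OF assms] by (force intro!: prod_pos, intro prod_mono) (simp add: less_imp_le)

lemma ln_one_plus_lower: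
  assumes "0 \<le> (y::real)"
  shows "2 * y / (2 + y) \<le> ln (1 + y)"
proof -
  let ?f = "\<lambda>y::real. ln (1 + y) - 2 * y / (2 + y)"
  have "?f 0 \<le> ?f y"
  proof (rule DERIV_nonneg_imp_nondecreasing[OF assms])
    fix x :: real assume "0 \<le> x" "x \<le> y"
    then have "(?f has_real_derivative (1 / (1 + x) - 4 / (2 + x)\<^sup>2)) (at x)"
      by (auto intro!: derivative_eq_intros simp: field_simps power2_eq_square)
    moreover have "0 \<le> 1 / (1 + x) - 4 / (2 + x)\<^sup>2"
    proof -
      have "1 / (1 + x) - 4 / (2 + x)\<^sup>2 = x\<^sup>2 / ((1 + x) * (2 + x)\<^sup>2)"
        using \<open>0 \<le> x\<close> by (simp add: divide_simps) (simp add: power2_eq_square algebra_simps)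
      then show ?thesis using \<open>0 \<le> x\<close> by simp
    qed
    ultimately show "\<exists>d. (?f has_real_derivative d) (at x) \<and> 0 \<le> d" by blast
  qed
  then show ?thesis by simp
qed

lemma iter_log_partial_sum_le:
  assumes "0 < t" "t < 1"
  shows "(\<Sum>i<N. \<Prod>j=1..Suc i. iter_log j t) \<le> 2 / (- ln t)"
  using assms
proof (induction N arbitrary: t)
  case 0
  then show ?case by simp
next
  case (Suc N)
  define y where "y = - ln t"
  have y: "0 < y" using Suc.prems by (simp add: y_def)
  define s where "s = iter_log 1 t"
  have s: "s = 1 / (1 + y)" by (simp add: s_def y_def)
  have s01: "0 < s" "s < 1" using y by (auto simp: s field_simps)
  have lns: "- ln s = ln (1 + y)" using y by (simp add: s ln_div)
  have "(\<Sum>i<Suc N. \<Prod>j=1..Suc i. iter_log j t)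
      = s + (\<Sum>i<N. \<Prod>j=1..Suc (Suc i). iter_log j t)"
    by (subst sum.lessThan_Suc_shift) (simp add: s_def)
  also have "\<dots> = s * (1 + (\<Sum>i<N. \<Prod>j=1..Suc i. iter_log j s))"
    by (simp only: iter_log_prod_Suc s_def sum_distrib_left distrib_left mult_1_right)
  also have "\<dots> \<le> s * (1 + 2 / ln (1 + y))"
    using Suc.IH[OF s01] s01 unfolding lns by (intro mult_left_mono) auto
  also have "\<dots> \<le> s * (1 + 2 / (2 * y / (2 + y)))"
    using ln_one_plus_lower[of y] y s01
    by (intro mult_left_mono add_left_mono divide_left_mono mult_pos_pos) auto
  also have "\<dots> = 2 / y"
    using y unfolding s by (simp add: divide_simps)
  finally show ?case by (simp add: y_def)
qed

lemma iter_log_summable: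
  assumes "0 < t" "t < 1"
  shows "summable (\<lambda>i. \<Prod>j=1..Suc i. iter_log j t)"
  by (rule bounded_imp_summable[where B = "2 / (- ln t)"])
     (use iter_log_prod_mono(1)[of t t] iter_log_partial_sum_le[OF assms, of "Suc n" for n] assms
       in \<open>auto simp: less_imp_le lessThan_Suc_atMost simp del: prod.cl_ivl_Suc sum.lessThan_Suc\<close>)

lemma iter_log_suminf_strict_mono:
  assumes "0 < s" "s < t" "t < 1"
  shows "(\<Sum>i. \<Prod>j=1..Suc i. iter_log j s) < (\<Sum>i. \<Prod>j=1..Suc i. iter_log j t)"
proof -
  let ?P = "\<lambda>i t. \<Prod>j=1..Suc i. iter_log j t"
  have le: "?P i s \<le> ?P i t" for i using iter_log_prod_mono(2)[of s t i] assms by simp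
  have ss: "summable (\<lambda>i. ?P i s)" and st: "summable (\<lambda>i. ?P i t)"
    using iter_log_summable assms by auto
  have "?P 0 s < ?P 0 t"
  proof -
    have "ln s < ln t" "ln t < 0" using assms by auto
    then show ?thesis by (simp add: field_simps)
  qed
  then have "0 < ?P 0 t - ?P 0 s" by linarith
  then have "0 < (\<Sum>i. ?P i t - ?P i s)"
    by (intro suminf_pos2[of _ 0] summable_diff st ss) (use le in \<open>simp_all only: diff_ge_0_iff_ge\<close>)
  also have "\<dots> = (\<Sum>i. ?P i t) - (\<Sum>i. ?P i s)"
    by (rule suminf_diff[OF st ss, symmetric])
  finally show ?thesis by simp
qed

lemma kappa_unique: "\<exists>!\<kappa>. 1 < \<kappa> \<and> (\<lambda>i. \<Prod>j=1..Suc i. iter_log j (1 / \<kappa>)) sums (1 / 4)"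
proof -
  let ?P = "\<lambda>i t. \<Prod>j=1..Suc i. iter_log j t"
  define S where "S t = (\<Sum>i. ?P i t)" for t
  have e: "0 < exp (-8::real)" "exp (-8::real) \<le> exp (-3)" "exp (-3::real) < 1" by auto
  have "uniform_limit {exp (-8)..exp (-3)} (\<lambda>n t. \<Sum>i<n. ?P i t) (\<lambda>t. \<Sum>i. ?P i t) sequentially"
  proof (rule Weierstrass_m_test[OF _ iter_log_summable])
    fix n :: nat and t :: real assume t: "t \<in> {exp (-8)..exp (-3)}"
    then have "0 < t" using e(1) by (meson atLeastAtMost_iff less_le_trans)
    then show "norm (?P n t) \<le> ?P n (exp (-3))"
      using iter_log_prod_mono[of t "exp (-3)" n] t e by auto
  qed (use e in auto)
  moreover have "continuous_on {exp (-8)..exp (-3)} (\<lambda>t. \<Sum>i<n. ?P i t)" for n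
  proof (intro continuous_on_sum continuous_on_prod)
    fix j :: nat
    have "{exp (-8)..exp (-3)} \<subseteq> {0<..<1::real}"
      using e by (meson atLeastAtMost_iff greaterThanLessThan_iff le_less_trans less_le_trans subsetI)
    then show "continuous_on {exp (-8)..exp (-3)} (iter_log j)"
      by (rule continuous_on_subset[OF iter_log_continuous])
  qed
  ultimately have cont: "continuous_on {exp (-8)..exp (-3)} S"
    unfolding S_def by (intro uniform_limit_theorem[where F = sequentially]) auto
  have lo: "S (exp (-8)) \<le> 1 / 4"
    unfolding S_def
    by (rule suminf_le_const[OF iter_log_summable])
       (use iter_log_partial_sum_le[of "exp (-8)"] in \<open>auto simp del: prod.cl_ivl_Suc\<close>)
  have hi: "1 / 4 \<le> S (exp (-3))"
  proof -
    have "(\<Sum>i\<in>{0}. ?P i (exp (-3))) \<le> S (exp (-3))"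
      unfolding S_def
      by (rule sum_le_suminf[OF iter_log_summable])
         (use iter_log_prod_mono(1)[of "exp (-3)" "exp (-3)"] in \<open>auto simp: less_imp_le simp del: prod.cl_ivl_Suc\<close>)
    then show ?thesis by simp
  qed
  obtain t where t: "exp (-8) \<le> t" "t \<le> exp (-3)" "S t = 1 / 4"
    using IVT'[OF lo hi _ cont] by auto
  have t01: "0 < t" "t < 1" using t(1,2) e by linarith+
  show ?thesis
  proof (rule ex1I[of _ "1 / t"])
    have "(\<lambda>i. ?P i t) sums S t"
      unfolding S_def by (rule summable_sums[OF iter_log_summable[OF t01]])
    then have "(\<lambda>i. ?P i (1 / (1 / t))) sums (1 / 4)"
      using t(3) by (simp only: divide_divide_eq_right mult_1_left div_by_1)
    then show "1 < 1 / t \<and> (\<lambda>i. ?P i (1 / (1 / t))) sums (1 / 4)"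
      using t01 by simp
  next
    fix k :: real assume k: "1 < k \<and> (\<lambda>i. ?P i (1 / k)) sums (1 / 4)"
    then have "S (1 / k) = S t" using t(3) by (simp add: S_def sums_iff)
    then have "1 / k = t"
      using iter_log_suminf_strict_mono[of "1 / k" t] iter_log_suminf_strict_mono[of t "1 / k"] k t01
      unfolding S_def by (cases "1 / k" t rule: linorder_cases) auto
    then show "k = 1 / t" by auto
  qed
qed

end

theory Submission
  imports Defs
begin

text \<open>
  The inequality is proved with a vector field. For a test function \<open>u\<close> and a smooth field
  \<open>T\<close> on the half ball, integrating \<open>0 \<le> |\<nabla>u + u T|\<^sup>2\<close> by parts gives
  \<open>\<integral> |\<nabla>u|\<^sup>2 \<ge> \<integral> (div T - |T|\<^sup>2) u\<^sup>2\<close> (lemma \<open>Dirichlet_integral_ge_div_minus_square\<close>).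
  The support of \<open>u\<close> is a compact subset of the open half ball, so singularities of \<open>T\<close> on the
  boundary, in particular at the origin, do no harm.

  The field is \<open>T = - \<nabla>\<phi> / \<phi>\<close> for
  \<open>\<phi> = x\<^sub>m |x|\<^sup>-\<^sup>n\<^sup>/\<^sup>2 (X\<^sub>1 \<cdots> X\<^sub>N)\<^sup>-\<^sup>1\<^sup>/\<^sup>2 (1 - (|x|/R)\<^sup>1\<^sup>/\<^sup>2)\<close>. The first two factors
  alone give the constant \<open>n\<^sup>2/4\<close> (lemma \<open>half_ball_radial_Hardy\<close>), and reduce the rest to one
  variable: if \<open>- P\<close> is the logarithmic derivative of the other factors in \<open>ln r\<close>, the potential
  gained is \<open>(P' - P\<^sup>2) / |x|\<^sup>2\<close>. The product of iterated logarithms contributes exactly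
  \<open>(1/4) \<Sum> X\<^sub>1\<^sup>2 \<cdots> X\<^sub>i\<^sup>2\<close>. The last factor contributes at least \<open>(1/8) (|x|/R)\<^sup>1\<^sup>/\<^sup>2\<close>, provided
  that its interaction with the logarithms is controlled by \<open>\<Sum> X\<^sub>1 \<cdots> X\<^sub>i \<le> 1/4\<close>; this is
  what the scaling of the argument by \<^const>\<open>kappa\<close> ensures (lemma \<open>iter_log_Riccati\<close>).

  For each \<open>N\<close> this is the inequality with the series cut off after \<open>N\<close> terms. The terms are
  nonnegative, so the resulting uniform bound on the partial sums yields both the convergence of
  the series and the inequality for its sum.
\<close>

section \<open>Integration by parts for test functions\<close>

text \<open>
  The integral of a difference quotient of \<open>W\<close> vanishes because Lebesgue measure is invariant
  under translation. The mean value theorem bounds the quotients by \<open>B\<close>, and for steps of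
  length at most one they vanish outside one fixed ball, so dominated convergence applies.
\<close>
lemma integral_directional_derivative_eq_0:
  fixes W D :: "'a::euclidean_space \<Rightarrow> real"
  assumes der: "\<And>x. ((\<lambda>t. W (x + t *\<^sub>R e)) has_real_derivative D x) (at 0)"
    and int: "integrable lborel W"
    and K: "bounded K" "\<And>x. x \<notin> K \<Longrightarrow> W x = 0"
    and bound: "\<And>x. \<bar>D x\<bar> \<le> B"
  shows "(\<integral>x. D x \<partial>lborel) = 0"
proof -
  define h where "h k = 1 / real (Suc k)" for k
  define s where "s k x = (W (x + h k *\<^sub>R e) - W x) / h k" for k x
  have h: "0 < h k" "h k \<le> 1" for k by (auto simp: h_def)
  have hlim: "h \<longlonglongrightarrow> 0"
    unfolding h_def using LIMSEQ_inverse_real_of_nat by (simp add: inverse_eq_divide)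
  have lim: "(\<lambda>k. s k x) \<longlonglongrightarrow> D x" for x
  proof -
    have "((\<lambda>t. (W (x + t *\<^sub>R e) - W x) / t) \<longlongrightarrow> D x) (at 0)"
      using der[of x] by (simp add: has_field_derivative_iff)
    moreover have "filterlim h (at 0) sequentially"
      using hlim h(1) by (intro filterlim_atI always_eventually) (auto simp: less_imp_neq[symmetric])
    ultimately show ?thesis
      unfolding s_def by (rule filterlim_compose)
  qed
  have [measurable]: "W \<in> borel_measurable borel"
    using int by (simp add: borel_measurable_integrable)
  have s_meas [measurable]: "s k \<in> borel_measurable lborel" for k
    unfolding s_def by measurable
  have D_meas: "D \<in> borel_measurable lborel"
    by (rule borel_measurable_LIMSEQ_real[OF lim s_meas])
  have s_int: "(\<integral>x. s k x \<partial>lborel) = 0" for k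
  proof -
    have distr: "distr lborel borel (\<lambda>x. x + h k *\<^sub>R e) = lborel"
      unfolding add.commute[of _ "h k *\<^sub>R e"] by (rule lborel_distr_plus)
    have "integrable (distr lborel borel (\<lambda>x. x + h k *\<^sub>R e)) W"
      unfolding distr by (rule int)
    then have "integrable lborel (\<lambda>x. W (x + h k *\<^sub>R e))"
      by (subst (asm) integrable_distr_eq) auto
    moreover have "(\<integral>x. W (x + h k *\<^sub>R e) \<partial>lborel) = (\<integral>x. W x \<partial>lborel)"
      using integral_distr[of "\<lambda>x. x + h k *\<^sub>R e" lborel borel W] by (simp add: distr)
    ultimately show ?thesis
      unfolding s_def using int by simp
  qed
  (* A step of size h k <= 1 moves a point by at most norm e, which fixes the radius. *)
  obtain r where r: "\<And>x. x \<in> K \<Longrightarrow> norm x \<le> r"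
    using K(1) by (auto simp: bounded_iff)
  let ?C = "cball 0 (r + norm e)"
  have dom: "norm (s k x) \<le> B * indicator ?C x" for k x
  proof (cases "x \<in> ?C")
    case True
    have "((\<lambda>t. W (x + t *\<^sub>R e)) has_real_derivative D (x + t *\<^sub>R e)) (at t)" for t
    proof -
      have "(\<lambda>s. W (x + t *\<^sub>R e + s *\<^sub>R e)) = (\<lambda>s. W (x + (s + t) *\<^sub>R e))"
        by (simp add: scaleR_add_left add_ac)
      then show ?thesis
        using der[of "x + t *\<^sub>R e"] DERIV_shift[of "\<lambda>t. W (x + t *\<^sub>R e)" _ 0 t]
        by (simp only: add_0_left)
    qed
    then obtain z where "W (x + h k *\<^sub>R e) - W (x + 0 *\<^sub>R e) = (h k - 0) * D (x + z *\<^sub>R e)"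
      using MVT2[OF h(1)[of k], of "\<lambda>t. W (x + t *\<^sub>R e)" "\<lambda>t. D (x + t *\<^sub>R e)"]
      by blast
    then have "s k x = D (x + z *\<^sub>R e)"
      using h(1)[of k] by (simp add: s_def)
    then show ?thesis using bound True by simp
  next
    case False
    then have x: "r + norm e < norm x" by simp
    have "norm (h k *\<^sub>R e) \<le> norm e"
      using h[of k] by (simp add: mult_left_le_one_le)
    then have "r < norm (x + h k *\<^sub>R e)"
      using x norm_diff_ineq[of x "h k *\<^sub>R e"] by linarith
    moreover have "r < norm x" using x norm_ge_zero[of e] by linarith
    ultimately have "x \<notin> K" "x + h k *\<^sub>R e \<notin> K" using r by force+
    then show ?thesis using False K(2) by (simp add: s_def)
  qed
  have "(\<lambda>k. \<integral>x. s k x \<partial>lborel) \<longlonglongrightarrow> (\<integral>x. D x \<partial>lborel)"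
  proof (rule integral_dominated_convergence[where w = "\<lambda>x. B * indicator ?C x"])
    show "integrable lborel (\<lambda>x. B * indicator ?C x)"
      by (intro integrable_mult_right integrable_real_indicator)
         (use emeasure_lborel_cball_finite[of 0 "r + norm e"] in auto)
  qed (use lim dom D_meas s_meas in auto)
  then show ?thesis
    unfolding s_int using LIMSEQ_unique tendsto_const by metis
qed

lemma integrable_continuous_compact_support:
  fixes f :: "'a::euclidean_space \<Rightarrow> real"
  assumes "compact K" "K \<subseteq> S" "continuous_on S f" "\<And>x. x \<notin> K \<Longrightarrow> f x = 0"
  shows "integrable lborel f"
proof -
  have "integrable lborel (\<lambda>x. indicator K x *\<^sub>R f x)"
    by (rule borel_integrable_compact[OF assms(1) continuous_on_subset[OF assms(3,2)]])
  moreover have "(\<lambda>x. indicator K x *\<^sub>R f x) = f"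
    by (intro ext) (use assms(4) in \<open>auto simp: indicator_def\<close>)
  ultimately show ?thesis by simp
qed

lemma set_integral_eq_integral_of_vanishing:
  fixes f :: "'a \<Rightarrow> real"
  assumes "\<And>x. x \<notin> S \<Longrightarrow> f x = 0"
  shows "(LINT x:S|M. f x) = (\<integral>x. f x \<partial>M)"
  unfolding set_lebesgue_integral_def
  using assms by (intro Bochner_Integration.integral_cong) (auto simp: indicator_def)

lemma
  assumes "u \<in> test_functions \<Omega>"
  shows test_function_differentiable: "u differentiable (at x)"
    and test_function_continuous: "continuous_on S u"
    and test_function_partial_continuous: "continuous_on S (partial_deriv i u)"
    and test_function_compact_support: "compact (support u)"
    and test_function_support: "support u \<subseteq> \<Omega>"
    and test_function_zero: "x \<notin> support u \<Longrightarrow> u x = 0"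
    and test_function_grad_zero: "x \<notin> support u \<Longrightarrow> grad u x = 0"
proof -
  have C: "C_k k u" for k using assms by (simp add: test_functions_def)
  show cs: "compact (support u)" and "support u \<subseteq> \<Omega>"
    using assms by (auto simp: test_functions_def)
  show "u differentiable (at x)"
    using C[of 1] by (simp add: differentiable_on_def)
  show "continuous_on S u"
    using C[of 0] continuous_on_subset[of UNIV] by auto
  show "continuous_on S (partial_deriv i u)"
    using C[of "Suc 0"] continuous_on_subset[of UNIV] by auto
  show zero: "u x = 0" if "x \<notin> support u" for x
    using that closure_subset[of "{x. u x \<noteq> 0}"] unfolding support_def by blast
  show "grad u x = 0" if "x \<notin> support u"
  proof -
    have "((\<lambda>_. 0) has_derivative (\<lambda>_. 0)) (at x)" by simp
    then have "(u has_derivative (\<lambda>_. 0)) (at x)"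
      by (rule has_derivative_transform_within_open[of _ _ _ _ "- support u"])
         (use that zero cs compact_imp_closed in auto)
    then have "frechet_derivative u (at x) = (\<lambda>_. 0)"
      using frechet_derivative_at by metis
    then show ?thesis by (simp add: grad_def partial_deriv_def vec_eq_iff)
  qed
qed

lemma has_partial_deriv:
  fixes u :: "real^'n::finite \<Rightarrow> real"
  assumes "u differentiable (at x)"
  shows "((\<lambda>t. u (x + t *\<^sub>R axis i 1)) has_real_derivative partial_deriv i u x) (at 0)"
proof -
  let ?D = "frechet_derivative u (at x)"
  have D: "(u has_derivative ?D) (at x)"
    using assms frechet_derivative_works by blast
  have "((\<lambda>t::real. x + t *\<^sub>R axis i 1) has_derivative (\<lambda>t. t *\<^sub>R axis i 1)) (at 0)"
    by (auto intro!: derivative_eq_intros)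
  then have "((\<lambda>t. u (x + t *\<^sub>R axis i 1)) has_derivative (\<lambda>t. ?D (t *\<^sub>R axis i 1))) (at 0)"
    by (rule has_derivative_compose) (use D in simp)
  moreover have "?D (t *\<^sub>R axis i 1) = partial_deriv i u x * t" for t
    using linear_cmul[OF has_derivative_linear[OF D]] by (simp add: partial_deriv_def)
  ultimately show ?thesis by (simp add: has_field_derivative_def)
qed

text \<open>
  Expanding \<open>0 \<le> |\<nabla>u + u T|\<^sup>2\<close> gives
  \<open>|\<nabla>u|\<^sup>2 + div (u\<^sup>2 T) \<ge> (div T - |T|\<^sup>2) u\<^sup>2\<close>, and \<open>u\<^sup>2 T\<close>, extended by zero, is a
  compactly supported field whose divergence integrates to zero. For \<open>T = - \<nabla>\<phi> / \<phi>\<close> with a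
  positive \<open>\<phi>\<close> one has \<open>div T - |T|\<^sup>2 = - \<Delta>\<phi> / \<phi>\<close>: this is the ground state method for
  Hardy inequalities, in a form that never mentions \<open>\<phi>\<close>.

  Here \<open>D i\<close> is the derivative of the \<open>i\<close>-th component of \<open>T\<close> in the \<open>i\<close>-th direction, so that
  the sum of the \<open>D i\<close> is \<open>div T\<close>.
\<close>
lemma Dirichlet_integral_ge_div_minus_square:
  fixes u :: "real^'n::finite \<Rightarrow> real" and T :: "real^'n \<Rightarrow> real^'n"
  assumes u: "u \<in> test_functions \<Omega>" and \<Omega>: "open \<Omega>"
    and T: "continuous_on \<Omega> T"
    and der: "\<And>i x. x \<in> \<Omega> \<Longrightarrow>
      ((\<lambda>t. T (x + t *\<^sub>R axis i 1) $ i) has_real_derivative D i x) (at 0)"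
    and D: "\<And>i. continuous_on \<Omega> (D i)"
  shows "(LINT x:\<Omega>|lborel. ((\<Sum>i\<in>UNIV. D i x) - (norm (T x))\<^sup>2) * (u x)\<^sup>2)
    \<le> (LINT x:\<Omega>|lborel. (norm (grad u x))\<^sup>2)"
proof -
  note [continuous_intros] = test_function_continuous[OF u]
    test_function_partial_continuous[OF u] T D
  note K = test_function_compact_support[OF u] test_function_support[OF u]
  note zero = test_function_zero[OF u] and gzero = test_function_grad_zero[OF u]
  (* The components of u^2 T and the terms of its divergence. Both vanish off the support of u,
     whatever values T and D take outside \<Omega>. *)
  define W where "W i x = (u x)\<^sup>2 * T x $ i" for i x
  define E where "E i x = 2 * u x * partial_deriv i u x * T x $ i + (u x)\<^sup>2 * D i x" for i x
  have W_cont: "continuous_on \<Omega> (W i)" for i unfolding W_def by (intro continuous_intros)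
  have E_cont: "continuous_on \<Omega> (E i)" for i unfolding E_def by (intro continuous_intros)
  have W0: "x \<notin> support u \<Longrightarrow> W i x = 0" and E0: "x \<notin> support u \<Longrightarrow> E i x = 0" for i x
    using zero by (auto simp: W_def E_def)
  have E_int: "integrable lborel (E i)" for i
    by (rule integrable_continuous_compact_support[OF K E_cont]) (rule E0)
  have E_zero: "(\<integral>x. E i x \<partial>lborel) = 0" for i
  proof -
    have "bounded (E i ` support u)"
      using K E_cont[of i] by (meson compact_continuous_image compact_imp_bounded continuous_on_subset)
    then obtain B where "\<And>x. x \<in> support u \<Longrightarrow> \<bar>E i x\<bar> \<le> B"
      by (auto simp: bounded_iff)
    then have B: "\<bar>E i x\<bar> \<le> max B 0" for x
      by (cases "x \<in> support u") (auto simp: E0 le_max_iff_disj)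
    have "((\<lambda>t. W i (x + t *\<^sub>R axis i 1)) has_real_derivative E i x) (at 0)" for x
    proof (cases "x \<in> support u")
      case True
      then have x: "x \<in> \<Omega>" using K by auto
      have "((\<lambda>t. (u (x + t *\<^sub>R axis i 1))\<^sup>2 * T (x + t *\<^sub>R axis i 1) $ i)
              has_real_derivative E i x) (at 0)"
        unfolding E_def
        by (rule derivative_eq_intros has_partial_deriv[OF test_function_differentiable[OF u]] der[OF x] refl)+
           (simp add: algebra_simps)
      then show ?thesis by (simp add: W_def)
    next
      case False
      have "open ((\<lambda>t. x + t *\<^sub>R axis i 1) -` (- support u) :: real set)"
        by (intro continuous_open_vimage continuous_intros open_Compl compact_imp_closed K)
      moreover have "(0::real) \<in> (\<lambda>t. x + t *\<^sub>R axis i 1) -` (- support u)"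
        using False by simp
      ultimately have "((\<lambda>t. W i (x + t *\<^sub>R axis i 1)) has_real_derivative 0) (at 0)"
        by (rule has_field_derivative_transform_within_open[OF DERIV_const]) (simp add: W0)
      then show ?thesis using E0[OF False] by simp
    qed
    moreover have "integrable lborel (W i)"
      by (rule integrable_continuous_compact_support[OF K W_cont]) (rule W0)
    ultimately show ?thesis
      using compact_imp_bounded[OF K(1)] W0 B by (rule integral_directional_derivative_eq_0)
  qed
  let ?V = "\<lambda>x. ((\<Sum>i\<in>UNIV. D i x) - (norm (T x))\<^sup>2) * (u x)\<^sup>2"
  have grad_cont: "continuous_on \<Omega> (grad u)"
    unfolding grad_def by (intro continuous_intros)
  have V_int: "integrable lborel ?V"
    by (rule integrable_continuous_compact_support[OF K])
       (intro continuous_intros, simp add: zero)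
  have G_int: "integrable lborel (\<lambda>x. (norm (grad u x))\<^sup>2)"
    by (rule integrable_continuous_compact_support[OF K])
       (intro continuous_intros grad_cont, simp add: gzero)
  have "?V x \<le> (norm (grad u x))\<^sup>2 + (\<Sum>i\<in>UNIV. E i x)" for x
  proof -
    have "(\<Sum>i\<in>UNIV. E i x) = 2 * u x * (grad u x \<bullet> T x) + (u x)\<^sup>2 * (\<Sum>i\<in>UNIV. D i x)"
      by (simp add: E_def sum.distrib inner_vec_def grad_def sum_distrib_left mult.assoc)
    moreover have "0 \<le> (norm (grad u x + u x *\<^sub>R T x))\<^sup>2" by simp
    moreover have "(norm (grad u x + u x *\<^sub>R T x))\<^sup>2
        = (norm (grad u x))\<^sup>2 + 2 * u x * (grad u x \<bullet> T x) + (u x)\<^sup>2 * (norm (T x))\<^sup>2"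
      unfolding power2_norm_eq_inner
      by (simp add: inner_simps inner_commute algebra_simps power2_eq_square)
    ultimately show ?thesis by (simp add: algebra_simps)
  qed
  then have "(\<integral>x. ?V x \<partial>lborel) \<le> (\<integral>x. (norm (grad u x))\<^sup>2 + (\<Sum>i\<in>UNIV. E i x) \<partial>lborel)"
    using V_int G_int E_int by (intro integral_mono) auto
  also have "\<dots> = (\<integral>x. (norm (grad u x))\<^sup>2 \<partial>lborel)"
    using G_int E_int E_zero by simp
  finally show ?thesis
    using K(2) zero gzero
    by (subst (1 2) set_integral_eq_integral_of_vanishing) auto
qed

section \<open>Iterated logarithms and a Riccati inequality\<close>

definition iter_log_prod :: "nat \<Rightarrow> real \<Rightarrow> real" where
  "iter_log_prod i t = (\<Prod>j=1..Suc i. iter_log j t)"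

definition iter_log_sum :: "nat \<Rightarrow> real \<Rightarrow> real" where
  "iter_log_sum N t = (\<Sum>i<N. iter_log_prod i t)"

text \<open>
  In the variable \<open>ln t\<close> this reads \<open>X\<^sub>k' = X\<^sub>1 \<cdots> X\<^sub>k X\<^sub>k\<close>. It follows from the case
  \<open>X\<^sub>1' = X\<^sub>1\<^sup>2\<close> by the chain rule, since \<open>X\<^sub>k\<^sub>+\<^sub>1 = X\<^sub>k \<circ> X\<^sub>1\<close>.
\<close>
lemma iter_log_has_derivative:
  assumes "0 < t" "t < 1"
  shows "(iter_log k has_real_derivative (\<Prod>j=1..k. iter_log j t) * iter_log k t / t) (at t)"
  using assms
proof (induction k arbitrary: t)
  case 0
  have "iter_log 0 = (\<lambda>t. t)" by auto
  then show ?case using 0 by simp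
next
  case (Suc k)
  define s where "s = 1 / (1 - ln t)"
  have s1: "iter_log 1 t = s" by (simp add: s_def)
  have ln: "1 - ln t \<noteq> 0" using Suc.prems ln_less_zero[of t] by linarith
  have s: "0 < s" "s < 1" using iter_log_mono[of t t 1] Suc.prems s1 by auto
  have "((\<lambda>t. 1 / (1 - ln t)) has_real_derivative s\<^sup>2 / t) (at t)"
    using Suc.prems ln unfolding s_def
    by (auto intro!: derivative_eq_intros simp: field_simps power2_eq_square)
  from DERIV_chain2[of "iter_log k" _ "\<lambda>t. 1 / (1 - ln t)", OF _ this]
  have "((\<lambda>t. iter_log k (1 / (1 - ln t))) has_real_derivative
      (\<Prod>j=1..k. iter_log j s) * iter_log k s / s * (s\<^sup>2 / t)) (at t)"
    using Suc.IH[OF s] unfolding s_def by blast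
  moreover have "(\<Prod>j=1..Suc k. iter_log j t) = s * (\<Prod>j=1..k. iter_log j s)"
  proof (cases k)
    case 0
    then show ?thesis by (simp add: s_def)
  next
    case (Suc i)
    then show ?thesis using iter_log_prod_Suc[of t i] by (simp only: s1)
  qed
  moreover have "iter_log (Suc k) = (\<lambda>t. iter_log k (1 / (1 - ln t)))" by auto
  ultimately show ?case
    using s by (simp add: s_def[symmetric] power2_eq_square mult_ac)
qed

lemma iter_log_prod_has_derivative:
  assumes "0 < t" "t < 1"
  shows "(iter_log_prod i has_real_derivative
    iter_log_prod i t * iter_log_sum (Suc i) t / t) (at t)"
proof (induction i)
  case 0
  have "iter_log_prod 0 = iter_log 1" by (auto simp: iter_log_prod_def)
  then show ?case
    using iter_log_has_derivative[OF assms, of 1]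
    by (simp add: iter_log_sum_def del: iter_log.simps One_nat_def)
next
  case (Suc i)
  have eq: "iter_log_prod (Suc i) = (\<lambda>t. iter_log_prod i t * iter_log (Suc (Suc i)) t)"
    by (auto simp: iter_log_prod_def)
  have "(iter_log (Suc (Suc i)) has_real_derivative
      iter_log_prod (Suc i) t * iter_log (Suc (Suc i)) t / t) (at t)"
    using iter_log_has_derivative[OF assms, of "Suc (Suc i)"] by (simp add: iter_log_prod_def)
  from DERIV_mult[OF Suc this] show ?case
    unfolding eq[symmetric]
    by (rule DERIV_cong) (use assms in \<open>simp add: eq iter_log_sum_def field_simps del: iter_log.simps\<close>)
qed

text \<open>
  With \<open>\<eta>\<close> the partial sum and \<open>p\<^sub>i\<close> its terms, the derivative in \<open>ln t\<close> is
  \<open>\<Sum>\<^sub>i p\<^sub>i \<Sum>\<^sub>j\<^sub>\<le>\<^sub>i p\<^sub>j\<close>, which is half of \<open>\<eta>\<^sup>2 + \<Sum>\<^sub>i p\<^sub>i\<^sup>2\<close> by symmetry. Therefore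
  \<open>P = \<eta> / 2\<close> solves the Riccati equation \<open>P' - P\<^sup>2 = (1/4) \<Sum>\<^sub>i p\<^sub>i\<^sup>2\<close>, which is where
  the coefficient of the logarithmic series comes from.
\<close>
lemma iter_log_sum_has_derivative:
  assumes "0 < t" "t < 1"
  shows "(iter_log_sum N has_real_derivative
    ((iter_log_sum N t)\<^sup>2 + (\<Sum>i<N. (iter_log_prod i t)\<^sup>2)) / (2 * t)) (at t)"
proof (induction N)
  case 0
  have "iter_log_sum 0 = (\<lambda>_. 0)" by (auto simp: iter_log_sum_def)
  then show ?case by simp
next
  case (Suc N)
  have eq: "iter_log_sum (Suc N) = (\<lambda>t. iter_log_sum N t + iter_log_prod N t)"
    by (auto simp: iter_log_sum_def)
  from DERIV_add[OF Suc iter_log_prod_has_derivative[OF assms, of N]] show ?case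
    unfolding eq[symmetric]
    by (rule DERIV_cong) (use assms in \<open>simp add: eq field_simps power2_eq_square\<close>)
qed

lemma iter_log_prod_continuous: "continuous_on {0<..<1} (iter_log_prod i)"
  unfolding iter_log_prod_def by (intro continuous_on_prod iter_log_continuous)

lemma iter_log_sum_continuous: "continuous_on {0<..<1} (iter_log_sum N)"
  unfolding iter_log_sum_def by (intro continuous_on_sum iter_log_prod_continuous)

lemma kappa_gt_1: "1 < kappa"
  and kappa_sums: "(\<lambda>i. iter_log_prod i (1 / kappa)) sums (1 / 4)"
  using theI'[OF kappa_unique] unfolding kappa_def[symmetric] iter_log_prod_def by auto

text \<open>This bound is what the choice of \<^const>\<open>kappa\<close> is made for.\<close>
lemma iter_log_sum_le_quarter:
  assumes "0 < t" "t \<le> 1 / kappa"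
  shows "iter_log_sum N t \<le> 1 / 4"
proof -
  have k: "1 / kappa < 1" using kappa_gt_1 by simp
  have "iter_log_sum N t \<le> iter_log_sum N (1 / kappa)"
    unfolding iter_log_sum_def iter_log_prod_def
    by (intro sum_mono iter_log_prod_mono(2) assms k)
  also have "\<dots> \<le> (\<Sum>i. iter_log_prod i (1 / kappa))"
    unfolding iter_log_sum_def
  proof (rule sum_le_suminf)
    show "summable (\<lambda>i. iter_log_prod i (1 / kappa))" using kappa_sums sums_summable by blast
    show "0 \<le> iter_log_prod i (1 / kappa)" for i
      unfolding iter_log_prod_def using iter_log_prod_mono(1)[of "1/kappa" "1/kappa" i] k kappa_gt_1 by simp
  qed auto
  also have "\<dots> = 1 / 4" using kappa_sums sums_unique by metis
  finally show ?thesis .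
qed

text \<open>
  Let \<open>w = (r/R)\<^sup>1\<^sup>/\<^sup>2\<close>, and let primes denote derivatives in \<open>ln r\<close>, so that \<open>w' = w / 2\<close>.
  The term added to \<open>\<eta> / 2\<close> is \<open>q = - \<psi>' / \<psi>\<close> for \<open>\<psi> = 1 - w\<close>, which is positive up to
  the sphere of radius \<open>R\<close>. It changes \<open>P' - P\<^sup>2\<close> by
  \<open>q' - q\<^sup>2 - \<eta> q = (w / (1 - w)) (1/4 - \<eta>/2)\<close>. As \<open>\<eta> \<le> 1/4\<close>, this is at least
  \<open>w / (8 (1 - w)) \<ge> w / 8\<close>, the extra potential of the inequality. In the lemma \<open>Q\<close> is the
  derivative of \<open>P\<close> in \<open>ln r\<close>.
\<close>
lemma iter_log_Riccati:
  fixes R r :: real and N :: nat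
  assumes "0 < R" "0 < r" "r < R"
  defines "w \<equiv> \<lambda>r. sqrt (r / R)"
  defines "\<eta> \<equiv> \<lambda>r. iter_log_sum N (r / (kappa * R))"
    and "S \<equiv> \<lambda>r. (\<Sum>i<N. (iter_log_prod i (r / (kappa * R)))\<^sup>2)"
  defines "P \<equiv> \<lambda>r. \<eta> r / 2 + w r / 2 / (1 - w r)"
    and "Q \<equiv> \<lambda>r. ((\<eta> r)\<^sup>2 + S r) / 4 + w r / 4 / (1 - w r)\<^sup>2"
  shows "(P has_real_derivative Q r / r) (at r)"
    and "S r / 4 + w r / 8 \<le> Q r - (P r)\<^sup>2"
proof -
  define t where "t = r / (kappa * R)"
  have t: "0 < t" "t < 1 / kappa" "t < 1"
    using assms(1-3) kappa_gt_1 mult_strict_mono[of 1 kappa r R] by (auto simp: t_def field_simps)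
  have w: "0 < w r" "w r < 1" using assms(1-3) by (auto simp: w_def)
  have w2: "(w r)\<^sup>2 = r / R" using assms(1-3) by (simp add: w_def)
  have "((\<lambda>r. r / (kappa * R)) has_real_derivative t / r) (at r)"
    using assms(1,2) kappa_gt_1 by (auto intro!: derivative_eq_intros simp: t_def)
  from DERIV_chain2[OF iter_log_sum_has_derivative[OF t(1,3)[unfolded t_def]] this, of N]
  have "(\<eta> has_real_derivative ((\<eta> r)\<^sup>2 + S r) / (2 * t) * (t / r)) (at r)"
    by (simp add: \<eta>_def S_def t_def)
  then have d\<eta>: "(\<eta> has_real_derivative ((\<eta> r)\<^sup>2 + S r) / (2 * r)) (at r)"
    by (rule DERIV_cong) (use t in simp)
  have "(w has_real_derivative 1 / R * (inverse (w r) / 2)) (at r)"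
    unfolding w_def using assms(1,2) by (auto intro!: derivative_eq_intros simp: divide_less_0_iff)
  moreover have "1 / R * (inverse (w r) / 2) = w r / (2 * r)"
    using w w2 assms(1,2) by (simp add: field_simps power2_eq_square)
  ultimately have dw: "(w has_real_derivative w r / (2 * r)) (at r)" by simp
  have ne: "1 - w r \<noteq> 0" using w by simp
  show "(P has_real_derivative Q r / r) (at r)"
    unfolding P_def
    apply (rule derivative_eq_intros d\<eta> dw refl ne | simp add: ne)+
    using ne assms(2) unfolding Q_def by (simp add: divide_simps) (simp add: algebra_simps power2_eq_square)
  (* This q is twice the added logarithmic derivative. *)
  define q where "q = w r / (1 - w r)"
  have q: "w r \<le> q" using w by (simp add: q_def field_simps)
  have "w r / 4 / (1 - w r)\<^sup>2 - (q / 2)\<^sup>2 = q / 4"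
    using ne by (simp add: q_def divide_simps) (simp add: algebra_simps power2_eq_square)
  moreover have "P r = \<eta> r / 2 + q / 2" by (simp add: P_def q_def)
  then have "(P r)\<^sup>2 = (\<eta> r)\<^sup>2 / 4 + \<eta> r * q / 2 + (q / 2)\<^sup>2"
    by (simp add: power2_eq_square algebra_simps)
  moreover have "Q r = (\<eta> r)\<^sup>2 / 4 + S r / 4 + w r / 4 / (1 - w r)\<^sup>2"
    by (simp add: Q_def add_divide_distrib)
  ultimately have "Q r - (P r)\<^sup>2 = S r / 4 + q / 4 - \<eta> r * q / 2"
    by linarith
  moreover have "\<eta> r * q \<le> 1 / 4 * q"
    using iter_log_sum_le_quarter[OF t(1), of N] t w q
    by (intro mult_right_mono) (auto simp: \<eta>_def t_def[symmetric])
  ultimately show "S r / 4 + w r / 8 \<le> Q r - (P r)\<^sup>2" using q by linarith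
qed

section \<open>A Hardy inequality with radial weight on the half ball\<close>

lemma open_half_ball: "open (half_ball m R)"
  unfolding half_ball_def by (intro open_Collect_conj open_Collect_less continuous_intros)

lemma half_ball_norm:
  assumes "x \<in> half_ball m R"
  shows "0 < x $ m" "0 < norm x" "norm x < R"
  using assms by (auto simp: half_ball_def)

lemma norm_has_partial_derivative:
  fixes x :: "real^'n::finite"
  assumes "x \<noteq> 0"
  shows "((\<lambda>t. norm (x + t *\<^sub>R axis i 1)) has_real_derivative x $ i / norm x) (at 0)"
proof -
  have "(norm (x + t *\<^sub>R axis i 1))\<^sup>2 = (norm x)\<^sup>2 + 2 * t * x $ i + t\<^sup>2" for t
    unfolding power2_norm_eq_inner
    by (simp add: inner_simps inner_axis inner_axis' power2_eq_square distrib_left)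
  then have "norm (x + t *\<^sub>R axis i 1) = sqrt ((norm x)\<^sup>2 + 2 * t * x $ i + t\<^sup>2)" for t
    by (metis norm_ge_zero real_sqrt_unique)
  moreover have "((\<lambda>t. sqrt ((norm x)\<^sup>2 + 2 * t * x $ i + t\<^sup>2))
      has_real_derivative x $ i / norm x) (at 0)"
    using assms by (auto intro!: derivative_eq_intros simp: field_simps)
  ultimately show ?thesis by simp
qed

text \<open>
  The field is \<open>T = - \<nabla>\<phi> / \<phi>\<close> for \<open>\<phi> = x\<^sub>m |x|\<^sup>-\<^sup>n\<^sup>/\<^sup>2 g(|x|)\<close>, where \<open>- P\<close> is the derivative
  of \<open>ln g\<close> in \<open>ln r\<close> and \<open>Q\<close> that of \<open>P\<close>. The factor \<open>x\<^sub>m\<close>, the positive harmonic function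
  vanishing on the flat boundary, raises the Hardy constant from \<open>((n-2)/2)\<^sup>2\<close> to \<open>(n/2)\<^sup>2\<close>:
  with \<open>F = n/2 + P\<close> one finds
  \<open>div T - |T|\<^sup>2 = (n F + Q - F\<^sup>2) / |x|\<^sup>2\<close>, the terms \<open>1 / x\<^sub>m\<^sup>2\<close> cancelling. The exponent
  \<open>n/2\<close> maximises \<open>n F - F\<^sup>2\<close>, so that the terms linear in \<open>P\<close> cancel too.
\<close>
lemma half_ball_radial_Hardy:
  fixes u :: "real^'n::finite \<Rightarrow> real"
  assumes u: "u \<in> test_functions (half_ball m R)"
    and P: "\<And>r. 0 < r \<Longrightarrow> r < R \<Longrightarrow> (P has_real_derivative Q r / r) (at r)"
    and Q: "continuous_on {0<..<R} Q"
  shows "(LINT x:half_ball m R|lborel.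
      ((real CARD('n))\<^sup>2 / 4 + (Q (norm x) - (P (norm x))\<^sup>2)) * ((u x)\<^sup>2 / (norm x)\<^sup>2))
    \<le> (LINT x:half_ball m R|lborel. (norm (grad u x))\<^sup>2)"
proof -
  let ?H = "half_ball m R"
  define F where "F r = real CARD('n) / 2 + P r" for r
  define T :: "real^'n \<Rightarrow> real^'n" where
    "T x = (F (norm x) / (norm x)\<^sup>2) *\<^sub>R x - (1 / x $ m) *\<^sub>R axis m 1" for x
  define D :: "'n \<Rightarrow> real^'n \<Rightarrow> real" where
    "D i x = F (norm x) / (norm x)\<^sup>2 + (Q (norm x) - 2 * F (norm x)) * (x $ i)\<^sup>2 / (norm x) ^ 4
      + (if i = m then 1 / (x $ m)\<^sup>2 else 0)" for i x
  have F: "(F has_real_derivative Q r / r) (at r)" if "0 < r" "r < R" for r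
    unfolding F_def using P[OF that] by (auto intro!: derivative_eq_intros)
  have F_cont: "continuous_on {0<..<R} F"
    using F by (intro continuous_at_imp_continuous_on ballI DERIV_isCont) auto
  have sub: "norm ` ?H \<subseteq> {0<..<R}" using half_ball_norm by fastforce
  have F_norm [continuous_intros]: "continuous_on ?H (\<lambda>x. F (norm x))"
    by (rule continuous_on_compose2[OF F_cont _ sub]) (intro continuous_intros)
  have Q_norm [continuous_intros]: "continuous_on ?H (\<lambda>x. Q (norm x))"
    by (rule continuous_on_compose2[OF Q _ sub]) (intro continuous_intros)
  have ne: "x $ m \<noteq> 0" "norm x \<noteq> 0" if "x \<in> ?H" for x
    using half_ball_norm[OF that] by auto
  have T_cont: "continuous_on ?H T"
    unfolding T_def by (intro continuous_intros) (use ne in auto)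
  have D_cont: "continuous_on ?H (D i)" for i
    unfolding D_def by (cases "i = m"; simp; intro continuous_intros) (use ne in auto)
  have T_der: "((\<lambda>t. T (x + t *\<^sub>R axis i 1) $ i) has_real_derivative D i x) (at 0)"
    if x: "x \<in> ?H" for i x
  proof -
    define r where "r = norm x"
    have r: "0 < r" "r < R" "r \<noteq> 0" using half_ball_norm[OF x] by (auto simp: r_def)
    have d: "((\<lambda>t. norm (x + t *\<^sub>R axis i 1)) has_real_derivative x $ i / r) (at 0)"
      using norm_has_partial_derivative[of x i] r by (auto simp: r_def)
    have dF: "((\<lambda>t. F (norm (x + t *\<^sub>R axis i 1))) has_real_derivative Q r / r * (x $ i / r)) (at 0)"
      by (rule DERIV_chain2[OF _ d]) (use F[OF r(1,2)] in \<open>simp add: r_def\<close>)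
    have 1: "((\<lambda>t. F (norm (x + t *\<^sub>R axis i 1)) / (norm (x + t *\<^sub>R axis i 1))\<^sup>2 * (x $ i + t))
        has_real_derivative F r / r\<^sup>2 + (Q r - 2 * F r) * (x $ i)\<^sup>2 / r ^ 4) (at 0)"
      apply (rule derivative_eq_intros d dF refl | simp add: r_def[symmetric] r)+
      using r by (simp add: field_simps power2_eq_square power4_eq_xxxx)
    have 2: "((\<lambda>t. if i = m then - 1 / (x $ m + t) else 0)
        has_real_derivative (if i = m then 1 / (x $ m)\<^sup>2 else 0)) (at 0)"
      using ne(1)[OF x]
      by (auto intro!: derivative_eq_intros simp: power2_eq_square)
    have "T (x + t *\<^sub>R axis i 1) $ i
        = F (norm (x + t *\<^sub>R axis i 1)) / (norm (x + t *\<^sub>R axis i 1))\<^sup>2 * (x $ i + t)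
          + (if i = m then - 1 / (x $ m + t) else 0)" for t
      by (auto simp: T_def axis_def)
    with DERIV_add[OF 1 2] show ?thesis by (simp add: D_def r_def)
  qed
  have div: "(\<Sum>i\<in>UNIV. D i x) - (norm (T x))\<^sup>2
      = ((real CARD('n))\<^sup>2 / 4 + (Q (norm x) - (P (norm x))\<^sup>2)) / (norm x)\<^sup>2"
    if x: "x \<in> ?H" for x
  proof -
    define r where "r = norm x"
    have r: "r \<noteq> 0" using ne(2)[OF x] by (simp add: r_def)
    have sq: "(\<Sum>i\<in>UNIV. (x $ i)\<^sup>2) = r\<^sup>2"
      unfolding r_def power2_norm_eq_inner by (simp add: inner_vec_def power2_eq_square)
    have "(\<Sum>i\<in>UNIV. D i x)
        = real CARD('n) * F r / r\<^sup>2 + (Q r - 2 * F r) * (\<Sum>i\<in>UNIV. (x $ i)\<^sup>2) / r ^ 4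
          + 1 / (x $ m)\<^sup>2"
      by (simp add: D_def sum.distrib r_def[symmetric] sum_distrib_left sum_divide_distrib)
    also have "\<dots> = (real CARD('n) * F r + Q r - 2 * F r) / r\<^sup>2 + 1 / (x $ m)\<^sup>2"
      unfolding sq using r by (simp add: field_simps power2_eq_square power4_eq_xxxx)
    finally have "(\<Sum>i\<in>UNIV. D i x) = \<dots>" .
    moreover have "(norm (T x))\<^sup>2 = ((F r)\<^sup>2 - 2 * F r) / r\<^sup>2 + 1 / (x $ m)\<^sup>2"
    proof -
      have "(norm (a *\<^sub>R x - b *\<^sub>R axis m 1))\<^sup>2 = a\<^sup>2 * r\<^sup>2 - 2 * a * (b * x $ m) + b\<^sup>2" for a b
        unfolding r_def power2_norm_eq_inner
        by (simp add: inner_simps inner_axis inner_axis' power2_eq_square algebra_simps)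
      then have "(norm (T x))\<^sup>2 = (F r / r\<^sup>2)\<^sup>2 * r\<^sup>2 - 2 * (F r / r\<^sup>2) + 1 / (x $ m)\<^sup>2"
        using ne(1)[OF x] by (simp add: T_def r_def[symmetric] power_one_over)
      also have "(F r / r\<^sup>2)\<^sup>2 * r\<^sup>2 = (F r)\<^sup>2 / r\<^sup>2"
        using r by (simp add: power_divide power2_eq_square)
      finally show ?thesis by (simp add: diff_divide_distrib)
    qed
    moreover have "real CARD('n) * F r + Q r - 2 * F r - ((F r)\<^sup>2 - 2 * F r)
        = (real CARD('n))\<^sup>2 / 4 + (Q r - (P r)\<^sup>2)"
      unfolding F_def by (simp add: power2_eq_square algebra_simps)
    ultimately show ?thesis
      unfolding r_def[symmetric] by (simp add: diff_divide_distrib[symmetric])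
  qed
  have "(LINT x:?H|lborel.
      ((real CARD('n))\<^sup>2 / 4 + (Q (norm x) - (P (norm x))\<^sup>2)) * ((u x)\<^sup>2 / (norm x)\<^sup>2))
    = (LINT x:?H|lborel. ((\<Sum>i\<in>UNIV. D i x) - (norm (T x))\<^sup>2) * (u x)\<^sup>2)"
    unfolding set_lebesgue_integral_def
    by (intro Bochner_Integration.integral_cong refl) (auto simp: indicator_def div)
  also have "\<dots> \<le> (LINT x:?H|lborel. (norm (grad u x))\<^sup>2)"
    by (rule Dirichlet_integral_ge_div_minus_square[OF u open_half_ball T_cont T_der D_cont])
  finally show ?thesis .
qed

text \<open>
  The support of \<open>u\<close> stays away from the boundary of \<open>\<Omega>\<close>, so \<open>w\<close> may blow up there, as
  \<open>1/|x|\<^sup>2\<close> does at the origin for the half ball.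
\<close>
lemma set_integrable_test_function_square:
  fixes u :: "real^'n::finite \<Rightarrow> real"
  assumes u: "u \<in> test_functions \<Omega>" and w: "continuous_on \<Omega> w"
  shows "set_integrable lborel \<Omega> (\<lambda>x. (u x)\<^sup>2 * w x)"
proof -
  have "integrable lborel (\<lambda>x. (u x)\<^sup>2 * w x)"
    by (rule integrable_continuous_compact_support[OF test_function_compact_support[OF u]
          test_function_support[OF u]])
       (intro continuous_intros test_function_continuous[OF u] w,
        simp add: test_function_zero[OF u])
  moreover have "(\<lambda>x. indicator \<Omega> x *\<^sub>R ((u x)\<^sup>2 * w x)) = (\<lambda>x. (u x)\<^sup>2 * w x)"
    using test_function_zero[OF u] test_function_support[OF u]
    by (intro ext) (auto simp: indicator_def)
  ultimately show ?thesis by (simp add: set_integrable_def)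
qed

section \<open>The improved Hardy inequality\<close>

text \<open>
  Truncating the logarithmic series keeps the field \<open>T\<close> elementary; the constants do not
  depend on \<open>N\<close>, so the full series is reached by a limit.
\<close>
lemma half_ball_Hardy_partial_sum:
  fixes u :: "real^'n::finite \<Rightarrow> real"
  assumes R: "0 < R" and u: "u \<in> test_functions (half_ball m R)"
  defines "I \<equiv> \<lambda>w. LINT x:half_ball m R|lborel. (u x)\<^sup>2 / (norm x)\<^sup>2 * w x"
  shows "(real CARD('n))\<^sup>2 / 4 * I (\<lambda>x. 1)
      + 1 / 4 * (\<Sum>i<N. I (\<lambda>x. (iter_log_prod i (norm x / (kappa * R)))\<^sup>2))
      + 1 / 8 * I (\<lambda>x. sqrt (norm x / R))
    \<le> (LINT x:half_ball m R|lborel. (norm (grad u x))\<^sup>2)"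
proof -
  let ?H = "half_ball m R"
  define w where "w r = sqrt (r / R)" for r
  define \<eta> where "\<eta> r = iter_log_sum N (r / (kappa * R))" for r
  define p where "p i r = iter_log_prod i (r / (kappa * R))" for i r
  define S where "S r = (\<Sum>i<N. (p i r)\<^sup>2)" for r
  define P where "P r = \<eta> r / 2 + w r / 2 / (1 - w r)" for r
  define Q where "Q r = ((\<eta> r)\<^sup>2 + S r) / 4 + w r / 4 / (1 - w r)\<^sup>2" for r
  note defs = P_def Q_def S_def \<eta>_def p_def w_def
  have scale: "continuous_on {0<..<R} (\<lambda>r. r / (kappa * R))"
      "(\<lambda>r. r / (kappa * R)) ` {0<..<R} \<subseteq> {0<..<1}"
  proof -
    show "continuous_on {0<..<R} (\<lambda>r. r / (kappa * R))"
      using R kappa_gt_1 by (intro continuous_intros) auto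
    have "r < kappa * R" if "0 < r" "r < R" for r
      using that R kappa_gt_1 mult_strict_right_mono[of 1 kappa R] by linarith
    then show "(\<lambda>r. r / (kappa * R)) ` {0<..<R} \<subseteq> {0<..<1}"
      using R kappa_gt_1 by (auto simp: divide_less_eq)
  qed
  have [continuous_intros]: "continuous_on {0<..<R} \<eta>" "continuous_on {0<..<R} (p i)"
      "continuous_on {0<..<R} w" for i
    unfolding \<eta>_def p_def w_def
    by (rule continuous_on_compose2[OF iter_log_sum_continuous scale]
        continuous_on_compose2[OF iter_log_prod_continuous scale])+
       (intro continuous_intros, use R in auto)
  have w1: "w r \<noteq> 1" if "r \<in> {0<..<R}" for r using that R by (auto simp: w_def)
  have Q_cont: "continuous_on {0<..<R} Q"
    unfolding Q_def S_def by (intro continuous_intros) (use w1 in auto)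
  have P_cont: "continuous_on {0<..<R} P"
    unfolding P_def by (intro continuous_intros) (use w1 in auto)
  have "(P has_real_derivative Q r / r) (at r)" if "0 < r" "r < R" for r
    using iter_log_Riccati(1)[OF R that, of N] unfolding defs .
  then have hardy: "(LINT x:?H|lborel.
      ((real CARD('n))\<^sup>2 / 4 + (Q (norm x) - (P (norm x))\<^sup>2)) * ((u x)\<^sup>2 / (norm x)\<^sup>2))
    \<le> (LINT x:?H|lborel. (norm (grad u x))\<^sup>2)"
    by (intro half_ball_radial_Hardy[OF u _ Q_cont])
  have cn: "continuous_on ?H (\<lambda>x. f (norm x))" if "continuous_on {0<..<R} f" for f :: "real \<Rightarrow> real"
    by (rule continuous_on_compose2[OF that]) (use half_ball_norm in \<open>fastforce intro: continuous_intros\<close>)+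
  have int: "set_integrable lborel ?H (\<lambda>x. (u x)\<^sup>2 / (norm x)\<^sup>2 * f (norm x))"
    if "continuous_on {0<..<R} f" for f
  proof -
    have "continuous_on ?H (\<lambda>x. f (norm x) / (norm x)\<^sup>2)"
      by (intro continuous_intros cn[OF that]) (use half_ball_norm in fastforce)
    from set_integrable_test_function_square[OF u this] show ?thesis by simp
  qed
  define J where "J f = I (\<lambda>x. f (norm x))" for f
  have J_add: "J (\<lambda>r. f r + g r) = J f + J g"
    if "continuous_on {0<..<R} f" "continuous_on {0<..<R} g" for f g
    unfolding J_def I_def distrib_left by (rule set_integral_add(2)[OF that[THEN int]])
  have J_cmult: "J (\<lambda>r. a * f r) = a * J f" for a f
    unfolding J_def I_def mult.left_commute[of _ a] by (rule set_integral_mult_right)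
  have J_sum: "J (\<lambda>r. \<Sum>i<k. f i r) = (\<Sum>i<k. J (f i))"
    if "\<And>i. continuous_on {0<..<R} (f i)" for f :: "nat \<Rightarrow> real \<Rightarrow> real" and k
  proof (induction k)
    case 0
    show ?case by (simp add: J_def I_def)
  next
    case (Suc k)
    show ?case unfolding sum.lessThan_Suc Suc[symmetric]
      by (rule J_add) (intro continuous_intros that)+
  qed
  define c where "c = (real CARD('n))\<^sup>2 / 4"
  have "c * J (\<lambda>r. 1) + 1 / 4 * (\<Sum>i<N. J (\<lambda>r. (p i r)\<^sup>2)) + 1 / 8 * J w
      = J (\<lambda>r. c * 1 + 1 / 4 * (\<Sum>i<N. (p i r)\<^sup>2) + 1 / 8 * w r)"
  proof -
    have "continuous_on {0<..<R} (\<lambda>r. c * 1 + 1 / 4 * (\<Sum>i<N. (p i r)\<^sup>2))"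
      "continuous_on {0<..<R} (\<lambda>r. c * 1 :: real)" "continuous_on {0<..<R} (\<lambda>r. 1 / 8 * w r)"
      "continuous_on {0<..<R} (\<lambda>r. 1 / 4 * (\<Sum>i<N. (p i r)\<^sup>2))"
      "\<And>i. continuous_on {0<..<R} (\<lambda>r. (p i r)\<^sup>2)"
      by (intro continuous_intros; simp)+
    then show ?thesis by (simp only: J_add J_cmult J_sum)
  qed
  also have "\<dots> \<le> J (\<lambda>r. c + (Q r - (P r)\<^sup>2))"
    unfolding J_def I_def
  proof (rule set_integral_mono)
    show "(u x)\<^sup>2 / (norm x)\<^sup>2 * (c * 1 + 1 / 4 * (\<Sum>i<N. (p i (norm x))\<^sup>2) + 1 / 8 * w (norm x))
        \<le> (u x)\<^sup>2 / (norm x)\<^sup>2 * (c + (Q (norm x) - (P (norm x))\<^sup>2))" if "x \<in> ?H" for x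
    proof (rule mult_left_mono)
      show "c * 1 + 1 / 4 * (\<Sum>i<N. (p i (norm x))\<^sup>2) + 1 / 8 * w (norm x)
          \<le> c + (Q (norm x) - (P (norm x))\<^sup>2)"
        using iter_log_Riccati(2)[OF R half_ball_norm(2,3)[OF that], of N] unfolding defs by simp
    qed simp
  qed (intro int continuous_intros P_cont Q_cont)+
  also have "\<dots> = (LINT x:?H|lborel.
      (c + (Q (norm x) - (P (norm x))\<^sup>2)) * ((u x)\<^sup>2 / (norm x)\<^sup>2))"
    by (simp add: J_def I_def mult.commute)
  also have "\<dots> \<le> (LINT x:?H|lborel. (norm (grad u x))\<^sup>2)"
    using hardy by (simp add: c_def)
  finally show ?thesis by (simp add: c_def J_def p_def w_def)
qed

theorem lemma1:
  fixes m :: "'n::finite" and R :: real and u :: "real^'n \<Rightarrow> real"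
  assumes "2 \<le> CARD('n)"
    and "0 < R"
    and "u \<in> test_functions (half_ball m R)"
  shows "summable (\<lambda>i. LINT x:half_ball m R|lborel.
            (u x)\<^sup>2 / (norm x)\<^sup>2 * (\<Prod>j=1..Suc i. (iter_log j (norm x / (kappa * R)))\<^sup>2))
    \<and> (LINT x:half_ball m R|lborel. (norm (grad u x))\<^sup>2)
      \<ge> (real CARD('n))\<^sup>2 / 4 * (LINT x:half_ball m R|lborel. (u x)\<^sup>2 / (norm x)\<^sup>2)
        + 1 / 4 * (\<Sum>i. LINT x:half_ball m R|lborel.
            (u x)\<^sup>2 / (norm x)\<^sup>2 * (\<Prod>j=1..Suc i. (iter_log j (norm x / (kappa * R)))\<^sup>2))
        + 1 / (8 * R powr (1/2)) * (LINT x:half_ball m R|lborel. (u x)\<^sup>2 / norm x powr (3/2))"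
proof -
  let ?H = "half_ball m R"
  define a where "a i = (LINT x:?H|lborel.
    (u x)\<^sup>2 / (norm x)\<^sup>2 * (\<Prod>j=1..Suc i. (iter_log j (norm x / (kappa * R)))\<^sup>2))" for i
  define G where "G = (LINT x:?H|lborel. (norm (grad u x))\<^sup>2)"
  define L where "L = (real CARD('n))\<^sup>2 / 4 * (LINT x:?H|lborel. (u x)\<^sup>2 / (norm x)\<^sup>2)
    + 1 / (8 * R powr (1/2)) * (LINT x:?H|lborel. (u x)\<^sup>2 / norm x powr (3/2))"
  have last: "1 / 8 * (LINT x:?H|lborel. (u x)\<^sup>2 / (norm x)\<^sup>2 * sqrt (norm x / R))
      = 1 / (8 * R powr (1/2)) * (LINT x:?H|lborel. (u x)\<^sup>2 / norm x powr (3/2))"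
  proof -
    have scale: "sqrt (r / R) / r\<^sup>2 = 1 / R powr (1/2) / r powr (3/2)" if "0 < r" for r
    proof -
      have "r powr (3/2) * sqrt r = r\<^sup>2"
        using that by (simp add: powr_half_sqrt[symmetric] powr_add[symmetric])
      then show ?thesis
        using that assms(2) by (simp add: powr_half_sqrt real_sqrt_divide field_simps)
    qed
    have "(u x)\<^sup>2 / (norm x)\<^sup>2 * sqrt (norm x / R)
        = 1 / R powr (1/2) * ((u x)\<^sup>2 / norm x powr (3/2))" if "x \<in> ?H" for x
    proof -
      have "(u x)\<^sup>2 / (norm x)\<^sup>2 * sqrt (norm x / R) = (u x)\<^sup>2 * (sqrt (norm x / R) / (norm x)\<^sup>2)"
        by simp
      then show ?thesis unfolding scale[OF half_ball_norm(2)[OF that]] by simp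
    qed
    then have "(LINT x:?H|lborel. (u x)\<^sup>2 / (norm x)\<^sup>2 * sqrt (norm x / R))
        = (LINT x:?H|lborel. 1 / R powr (1/2) * ((u x)\<^sup>2 / norm x powr (3/2)))"
      unfolding set_lebesgue_integral_def
      by (intro Bochner_Integration.integral_cong refl) (auto simp: indicator_def)
    also have "\<dots> = 1 / R powr (1/2) * (LINT x:?H|lborel. (u x)\<^sup>2 / norm x powr (3/2))"
      by (rule set_integral_mult_right)
    finally show ?thesis by simp
  qed
  have "L + 1 / 4 * (\<Sum>i<N. a i) \<le> G" for N
    using half_ball_Hardy_partial_sum[OF assms(2,3), of N]
    unfolding iter_log_prod_def prod_power_distrib a_def[symmetric] last L_def G_def
    by (simp add: add_ac)
  then have bound: "(\<Sum>i<N. a i) \<le> 4 * (G - L)" for N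
    by (simp add: field_simps)
  have nonneg: "0 \<le> a i" for i
    unfolding a_def set_lebesgue_integral_def
    by (intro Bochner_Integration.integral_nonneg) (auto simp: indicator_def prod_nonneg)
  have summable: "summable a"
  proof (rule bounded_imp_summable[OF nonneg])
    show "(\<Sum>i\<le>N. a i) \<le> 4 * (G - L)" for N
      using bound[of "Suc N"] by (simp only: lessThan_Suc_atMost)
  qed
  have "(\<Sum>i. a i) \<le> 4 * (G - L)"
    by (rule suminf_le_const[OF summable bound])
  with summable show ?thesis
    unfolding a_def[symmetric] G_def[symmetric] by (simp add: L_def)
qed

end
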